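(* For every integer $n\ge 2$ and every integer $k$, the number $d_k(n)$ of divisions of a honeycomb strip of length $n$ into exactly $k$ pieces equals the coefficient of $x^ny^k$ in $$\begin{bmatrix} 1& 1 \end{bmatrix} \begin{bmatrix} 1 & 1 \\ y & 1+y \end{bmatrix}^{n-2} \begin{bmatrix} y \\ y^2 \end{bmatrix} x^n .$$
   Context: A honeycomb strip of length $n$ consists of $n$ hexagons labelled $1,\dots,n$ in which hexagon $i$ is adjacent exactly with hexagons $i\pm1$ and $i\pm2$ (when these exist); equivalently its inner dual is the graph $P_n^2$ on vertices $1,\dots,n$ with $i\sim j$ iff $1\le|i-j|\le2$. A division into $k$ pieces is a partition of the hexagons into $k$ blocks each inducing a connected subgraph of $P_n^2$. Here $x,y$ are formal variables. *)

theory Defs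
  imports
    "HOL-Library.Disjoint_Sets"
    "HOL-Computational_Algebra.Polynomial"
    "Graph_Theory.Graph_Theory"
    "Jordan_Normal_Form.Matrix"
begin

(* The simple graph P_n^2, represented as a digraph with both orientations of each edge. *)
definition honeycomb_strip :: "nat \<Rightarrow> nat pair_pre_digraph" where
  "honeycomb_strip n =
     \<lparr> pverts = {1..n},
       parcs = {(i, j). i \<in> {1..n} \<and> j \<in> {1..n} \<and>
                  1 \<le> \<bar>int i - int j\<bar> \<and> \<bar>int i - int j\<bar> \<le> 2} \<rparr>"

definition is_division :: "nat \<Rightarrow> nat set set \<Rightarrow> bool" where
  "is_division n P \<longleftrightarrow>
     partition_on {1..n} P \<and>
     (\<forall>B\<in>P. connected (with_proj (honeycomb_strip n) \<restriction> B))"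

definition num_divisions :: "int \<Rightarrow> nat \<Rightarrow> nat" where
  "num_divisions k n = card {P. is_division n P \<and> int (card P) = k}"

(* Bivariate polynomials are elements of Z[y][x]: the outer indeterminate is x,
   and y is the indeterminate of the coefficient ring, embedded as a constant in x. *)
definition var_x :: "int poly poly" where
  "var_x = [:0, 1:]"

definition var_y :: "int poly poly" where
  "var_y = [:[:0, 1:]:]"

(* Coefficient of x^n y^k; it is 0 for a negative exponent k. *)
definition coeff_xy :: "int poly poly \<Rightarrow> nat \<Rightarrow> int \<Rightarrow> int" where
  "coeff_xy p n k = (if k < 0 then 0 else coeff (coeff p n) (nat k))"

end

(* Hexagon n is adjacent only to n-1 and n-2, which are adjacent to each other. Hence deleting
   hexagon n+1 keeps every block connected, and a division of length n+1 arises uniquely from one of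
   length n by adding n+1 as a new block or attaching it to the block of n or to the block of n-1.
   The last two choices agree exactly if n-1 and n share a block, so the divisions in which the last
   two hexagons are together and those in which they are apart obey a linear recurrence with the
   given transfer matrix. *)

theory Submission
  imports Defs
begin

section \<open>Connectivity in \<open>P_n^2\<close> as a bounded-gap condition\<close>

section \<open>Connected pieces\<close>

text \<open>Walks in \<open>P_n^2\<close> take steps of length at most two, so a connected block
  cannot skip two consecutive hexagons. The empty set satisfies this condition, so nonemptiness has
  to be stated separately.\<close>

definition gapless :: "nat set \<Rightarrow> bool" where
  "gapless B \<longleftrightarrow> (\<forall>a\<in>B. \<forall>c\<in>B. a < c \<longrightarrow> Suc a \<in> B \<or> Suc (Suc a) \<in> B)"

lemma gaplessD: "gapless B \<Longrightarrow> a \<in> B \<Longrightarrow> c \<in> B \<Longrightarrow> a < c \<Longrightarrow> Suc a \<in> B \<or> Suc (Suc a) \<in> B"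
  unfolding gapless_def by blast

text \<open>Connectivity is reachability in the symmetric closure of the arcs. The strip already
  holds both orientations of each edge, so the closure adds nothing. The additive bounds avoid
  truncated subtraction.\<close>

lemma symcl_arcs_ends_strip:
  assumes "B \<subseteq> {1..n}"
  shows "(arcs_ends (with_proj (honeycomb_strip n) \<restriction> B))\<^sup>s =
    {(i, j). i \<in> B \<and> j \<in> B \<and> i \<noteq> j \<and> i \<le> j + 2 \<and> j \<le> i + 2}" (is "?E\<^sup>s = ?R")
proof -
  have iff: "1 \<le> \<bar>int i - int j\<bar> \<and> \<bar>int i - int j\<bar> \<le> 2 \<longleftrightarrow> i \<noteq> j \<and> i \<le> j + 2 \<and> j \<le> i + 2" for i j
    by linarith
  have "?E = {(i, j). i \<in> B \<and> j \<in> B \<and> 1 \<le> \<bar>int i - int j\<bar> \<and> \<bar>int i - int j\<bar> \<le> 2}"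
    using assms by (auto simp: arcs_ends_conv honeycomb_strip_def image_iff)
  also have "\<dots> = ?R"
    by (simp only: iff)
  finally have "?E = ?R" .
  then show ?thesis
    by (auto simp: symcl_def image_iff)
qed

lemma connected_strip_iff:
  assumes "B \<subseteq> {1..n}"
  shows "connected (with_proj (honeycomb_strip n) \<restriction> B) \<longleftrightarrow> B \<noteq> {} \<and> gapless B"
proof -
  define R where "R = {(i, j). i \<in> B \<and> j \<in> B \<and> i \<noteq> j \<and> i \<le> j + 2 \<and> j \<le> i + 2}"
  have conn: "connected (with_proj (honeycomb_strip n) \<restriction> B) \<longleftrightarrow>
      B \<noteq> {} \<and> (\<forall>u\<in>B. \<forall>v\<in>B. (u, v) \<in> rtrancl_on B R)"
    unfolding connected_conv symcl_arcs_ends_strip[OF assms] R_def by simp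
  \<comment> \<open>Invariant of a walk from \<open>a\<close>: the first step that ends above
    \<open>a\<close> starts at or below \<open>a\<close>, so it lands on \<open>Suc a\<close> or
    \<open>Suc (Suc a)\<close>.\<close>
  have gap: "x \<le> a \<or> Suc a \<in> B \<or> Suc (Suc a) \<in> B" if "(a, x) \<in> rtrancl_on B R" for a x
    using that
  proof (induction rule: rtrancl_on_induct)
    case (step y z)
    show ?case
    proof (cases "y \<le> a \<and> a < z")
      case True
      then have "z = Suc a \<or> z = Suc (Suc a)" using step.hyps by (auto simp: R_def)
      then show ?thesis using step.hyps by auto
    qed (use step.IH in auto)
  qed simp
  \<comment> \<open>Conversely, climb from \<open>a\<close> to \<open>c\<close> by steps of at most
    two; the distance \<open>c - a\<close> shrinks each time.\<close>
  have up: "(a, c) \<in> rtrancl_on B R" if g: "gapless B" and "a \<in> B" and c: "c \<in> B" and "a \<le> c" for a c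
    using that(2,4)
  proof (induction "c - a" arbitrary: a rule: less_induct)
    case less
    show ?case
    proof (cases "a = c")
      case False
      then have "a < c" using less.prems by simp
      obtain b where b: "b \<in> B" "a < b" "b \<le> Suc (Suc a)" "b \<le> c"
      proof (cases "Suc a \<in> B")
        case True
        then show thesis using that[of "Suc a"] \<open>a < c\<close> by simp
      next
        case False
        then have "Suc (Suc a) \<in> B" using gaplessD[OF g less.prems(1) c \<open>a < c\<close>] by blast
        \<comment> \<open>Hence \<open>c\<close> is at least two above \<open>a\<close>, and the
          step of length two does not overshoot it.\<close>
        moreover have "c \<noteq> Suc a" using False c by blast
        ultimately show thesis using that[of "Suc (Suc a)"] \<open>a < c\<close> by simp
      qed
      then have "(b, c) \<in> rtrancl_on B R" using less by simp
      moreover have "(a, b) \<in> R" using b less.prems by (simp add: R_def)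
      ultimately show ?thesis
        using less.prems(1) by (blast intro: converse_rtrancl_on_into_rtrancl_on)
    qed (use c in simp)
  qed
  have "sym (rtrancl_on B R)"
    by (intro rtrancl_on_sym) (auto simp: R_def sym_def)
  then have "(u, v) \<in> rtrancl_on B R" if "gapless B" "u \<in> B" "v \<in> B" for u v
    using up that by (meson linear symD)
  moreover have "gapless B" if "\<forall>u\<in>B. \<forall>v\<in>B. (u, v) \<in> rtrancl_on B R"
    unfolding gapless_def using that gap by (meson leD)
  ultimately show ?thesis
    unfolding conn by blast
qed

text \<open>The hypotheses force \<open>m\<close> to be \<open>n - 1\<close> or \<open>n\<close>. An
  element below \<open>m\<close> already has a successor within \<open>B\<close>; any other element
  is \<open>n - 1\<close> or \<open>n\<close> and is adjacent to \<open>Suc n\<close>.\<close>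

lemma gapless_insert:
  assumes "gapless B" "B \<subseteq> {1..n}" "m \<in> B" "n \<le> Suc m"
  shows "gapless (insert (Suc n) B)"
  unfolding gapless_def
proof (intro ballI impI)
  fix a c
  assume a: "a \<in> insert (Suc n) B" and c: "c \<in> insert (Suc n) B" and "a < c"
  have "x \<le> n" if "x \<in> B" for x using assms(2) that by auto
  then have aB: "a \<in> B" "a \<le> n" using a c \<open>a < c\<close> by force+
  show "Suc a \<in> insert (Suc n) B \<or> Suc (Suc a) \<in> insert (Suc n) B"
  proof (cases "a < m")
    case True
    then show ?thesis using gaplessD[OF assms(1) aB(1) assms(3)] by auto
  next
    case False
    then have "a = n \<or> Suc a = n" using aB assms(4) by auto
    then show ?thesis by auto
  qed
qed

text \<open>Only \<open>a = n - 1\<close> could depend on \<open>Suc n\<close> for its continuation.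
  An element \<open>c\<close> above it that survives the removal must be \<open>n\<close>, which is
  adjacent to \<open>a\<close>.\<close>

lemma gapless_remove:
  assumes "gapless B" "B \<subseteq> {1..Suc n}"
  shows "gapless (B - {Suc n})"
  unfolding gapless_def
proof (intro ballI impI)
  fix a c
  assume a: "a \<in> B - {Suc n}" and c: "c \<in> B - {Suc n}" and "a < c"
  then have "c \<le> n" using assms(2) by auto
  have "Suc a \<in> B \<or> Suc (Suc a) \<in> B" using gaplessD[OF assms(1)] a c \<open>a < c\<close> by auto
  moreover have "Suc a \<in> B" if "Suc a = n"
  proof -
    have "c = Suc a" using that \<open>a < c\<close> \<open>c \<le> n\<close> by simp
    then show ?thesis using c by simp
  qed
  ultimately show "Suc a \<in> B - {Suc n} \<or> Suc (Suc a) \<in> B - {Suc n}"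
    using a c \<open>a < c\<close> \<open>c \<le> n\<close> by (cases "Suc a = n") auto
qed

lemma is_division_iff:
  "is_division n P \<longleftrightarrow> partition_on {1..n} P \<and> (\<forall>B\<in>P. gapless B)"
proof -
  have "connected (with_proj (honeycomb_strip n) \<restriction> B) \<longleftrightarrow> gapless B"
    if "partition_on {1..n} P" "B \<in> P" for B
    using connected_strip_iff[of B n] that by (auto simp: partition_on_def)
  then show ?thesis by (auto simp: is_division_def)
qed

lemma finite_divisions: "finite {P. is_division n P}"
  by (rule finite_subset[OF _ finitely_many_partition_on[of "{1..n}"]]) (auto simp: is_division_iff)

lemma is_division_block_subset: "is_division n P \<Longrightarrow> B \<in> P \<Longrightarrow> B \<subseteq> {1..n}"
  by (auto simp: is_division_iff partition_on_def)

lemma is_division_block_unique: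
  "is_division n P \<Longrightarrow> B \<in> P \<Longrightarrow> C \<in> P \<Longrightarrow> x \<in> B \<Longrightarrow> x \<in> C \<Longrightarrow> B = C"
  unfolding is_division_iff partition_on_def disjoint_def by blast

lemma is_division_obtain_block:
  assumes "is_division n P" "x \<in> {1..n}"
  obtains B where "B \<in> P" "x \<in> B"
proof -
  have "x \<in> \<Union>P" using assms by (simp add: is_division_iff partition_on_def)
  then show thesis using that by blast
qed

lemma is_division_finite: "is_division n P \<Longrightarrow> finite P"
  by (metis is_division_iff finite_atLeastAtMost finite_elements)

section \<open>Bijections between divisions of lengths n and n + 1\<close>

section \<open>Appending the last hexagon\<close>

definition together :: "'a \<Rightarrow> 'a \<Rightarrow> 'a set set \<Rightarrow> bool" where
  "together a b P \<longleftrightarrow> (\<exists>B\<in>P. a \<in> B \<and> b \<in> B)"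

text \<open>Mapping over all blocks avoids choosing the block of \<open>m\<close>; in a division at
  most one block is altered.\<close>

definition attach :: "'a \<Rightarrow> 'a \<Rightarrow> 'a set set \<Rightarrow> 'a set set" where
  "attach z m P = (\<lambda>B. if m \<in> B then insert z B else B) ` P"

text \<open>If \<open>{z}\<close> is a block, the image contains the empty set; this is why later
  uses require that \<open>z\<close> is not alone.\<close>

definition detach :: "'a \<Rightarrow> 'a set set \<Rightarrow> 'a set set" where
  "detach z P = (\<lambda>B. B - {z}) ` P"

lemma detach_attach: "z \<notin> \<Union>P \<Longrightarrow> detach z (attach z m P) = P"
  unfolding detach_def attach_def image_image
  by (subst image_cong[where g = "\<lambda>B. B"]) auto

lemma card_attach:
  assumes "z \<notin> \<Union>P"
  shows "card (attach z m P) = card P"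
  unfolding attach_def
  using assms by (intro card_image inj_on_inverseI[of P "\<lambda>B. B - {z}"]) auto

lemma together_attach:
  assumes "a \<noteq> z" "b \<noteq> z"
  shows "together a b (attach z m P) \<longleftrightarrow> together a b P"
  using assms by (auto simp: together_def attach_def)

lemma together_commute: "together a b P \<longleftrightarrow> together b a P"
  by (auto simp: together_def)

lemma together_trans:
  assumes P: "is_division n P" and "together a b P" "together b c P"
  shows "together a c P"
proof -
  obtain B C where B: "B \<in> P" "a \<in> B" "b \<in> B" and C: "C \<in> P" "b \<in> C" "c \<in> C"
    using assms(2,3) by (auto simp: together_def)
  then have "B = C" using is_division_block_unique[OF P] by blast
  then show ?thesis using B C by (auto simp: together_def)
qed

lemma Suc_notin_division: "is_division n P \<Longrightarrow> Suc n \<notin> \<Union>P"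
  by (auto simp: is_division_iff partition_on_def)

lemma not_together_if_singleton:
  assumes "is_division n P" "{z} \<in> P" "m \<noteq> z"
  shows "\<not> together m z P"
  unfolding together_def using is_division_block_unique[OF assms(1,2)] assms(3) by blast

lemma is_division_attach:
  assumes P: "is_division n P" and "n \<le> Suc m" "m \<in> {1..n}"
  shows "is_division (Suc n) (attach (Suc n) m P)" (is "is_division _ ?Q")
  unfolding is_division_iff
proof (intro conjI ballI)
  obtain B where B: "B \<in> P" "m \<in> B" using is_division_obtain_block[OF P assms(3)] by blast
  have U: "\<Union>P = {1..n}" using P by (auto simp: is_division_iff partition_on_def)
  show "partition_on {1..Suc n} ?Q"
  proof (rule partition_onI)
    have "\<Union>?Q = insert (Suc n) (\<Union>P)" using B by (auto simp: attach_def split: if_splits)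
    then show "\<Union>?Q = {1..Suc n}" using U by auto
    show "disjnt p q" if pq: "p \<in> ?Q" "q \<in> ?Q" "p \<noteq> q" for p q
    proof -
      obtain C D where CD: "C \<in> P" "D \<in> P"
        "p = (if m \<in> C then insert (Suc n) C else C)" "q = (if m \<in> D then insert (Suc n) D else D)"
        using pq(1,2) unfolding attach_def by blast
      then have "C \<inter> D = {}" using pq(3) is_division_block_unique[OF P CD(1,2)] by auto
      then show ?thesis
        using CD Suc_notin_division[OF P] by (auto simp: disjnt_def split: if_splits)
    qed
    show "{} \<notin> ?Q" using P by (auto simp: attach_def is_division_iff partition_on_def)
  qed
  fix C assume "C \<in> ?Q"
  then obtain D where D: "D \<in> P" "C = (if m \<in> D then insert (Suc n) D else D)"
    by (auto simp: attach_def)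
  then have "gapless D" "D \<subseteq> {1..n}" using P U by (auto simp: is_division_iff)
  then show "gapless C" using gapless_insert[of D n m] assms(2) D by auto
qed

lemma is_division_detach:
  assumes P: "is_division (Suc n) P" and "{Suc n} \<notin> P"
  shows "is_division n (detach (Suc n) P)"
  unfolding is_division_iff
proof (intro conjI ballI)
  have U: "\<Union>P = {1..Suc n}" using P by (auto simp: is_division_iff partition_on_def)
  have "{} \<notin> P" using P by (auto simp: is_division_iff partition_on_def)
  show "partition_on {1..n} (detach (Suc n) P)"
  proof (rule partition_onI)
    have "\<Union>(detach (Suc n) P) = \<Union>P - {Suc n}" by (auto simp: detach_def)
    then show "\<Union>(detach (Suc n) P) = {1..n}" using U by auto
    show "disjnt p q" if pq: "p \<in> detach (Suc n) P" "q \<in> detach (Suc n) P" "p \<noteq> q" for p q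
      using pq is_division_block_unique[OF P] unfolding detach_def disjnt_def by blast
    show "{} \<notin> detach (Suc n) P"
      using \<open>{} \<notin> P\<close> assms(2) by (auto simp: detach_def) (metis subset_singleton_iff)
  qed
  fix C assume "C \<in> detach (Suc n) P"
  then show "gapless C"
    using P gapless_remove is_division_block_subset[OF P] by (auto simp: detach_def is_division_iff)
qed

lemma attach_detach:
  assumes P: "is_division n P" and "together m z P" "m \<noteq> z"
  shows "attach z m (detach z P) = P"
proof -
  obtain B where B: "B \<in> P" "m \<in> B" "z \<in> B" using assms(2) by (auto simp: together_def)
  \<comment> \<open>The block containing \<open>m\<close> and \<open>z\<close> loses
    \<open>z\<close> and regains it; by disjointness every other block contains neither.\<close>
  have "(if m \<in> C - {z} then insert z (C - {z}) else C - {z}) = C" if "C \<in> P" for C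
  proof (cases "C = B")
    case True
    then show ?thesis using B assms(3) by auto
  next
    case False
    then have "m \<notin> C" "z \<notin> C" using is_division_block_unique[OF P that B(1)] B(2,3) by blast+
    then show ?thesis by simp
  qed
  then have "attach z m (detach z P) = (\<lambda>C. C) ` P"
    unfolding attach_def detach_def image_image by (intro image_cong refl)
  then show ?thesis by simp
qed

text \<open>Covers both neighbours \<open>m = n\<close> and \<open>m = n - 1\<close> of the new
  hexagon. On the target side \<open>Suc n\<close> shares its block with \<open>m\<close>, so
  detaching it leaves no empty block.\<close>

lemma bij_betw_attach:
  assumes "n \<le> Suc m" "m \<in> {1..n}"
  shows "bij_betw (attach (Suc n) m) {P. is_division n P}
    {P. is_division (Suc n) P \<and> together m (Suc n) P}"
proof (rule bij_betw_byWitness[where f' = "detach (Suc n)"])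
  have "m \<noteq> Suc n" using assms by auto
  show "\<forall>P\<in>{P. is_division n P}. detach (Suc n) (attach (Suc n) m P) = P"
    by (auto intro!: detach_attach dest: Suc_notin_division)
  show "\<forall>P\<in>{P. is_division (Suc n) P \<and> together m (Suc n) P}. attach (Suc n) m (detach (Suc n) P) = P"
    using attach_detach[of "Suc n" _ m "Suc n"] \<open>m \<noteq> Suc n\<close> by simp
  have "together m (Suc n) (attach (Suc n) m P)" if P: "is_division n P" for P
  proof -
    obtain B where "B \<in> P" "m \<in> B" using is_division_obtain_block[OF P assms(2)] .
    then have "insert (Suc n) B \<in> attach (Suc n) m P" by (force simp: attach_def)
    then show ?thesis using \<open>m \<in> B\<close> by (auto simp: together_def)
  qed
  then show "attach (Suc n) m ` {P. is_division n P}
      \<subseteq> {P. is_division (Suc n) P \<and> together m (Suc n) P}"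
    using is_division_attach[OF _ assms] by auto
  show "detach (Suc n) ` {P. is_division (Suc n) P \<and> together m (Suc n) P} \<subseteq> {P. is_division n P}"
    using not_together_if_singleton[OF _ _ \<open>m \<noteq> Suc n\<close>] by (auto intro!: is_division_detach)
qed

text \<open>The hypothesis makes the insertion a genuine one: if \<open>{Suc n}\<close> were already
  in \<open>P\<close>, the left side could hold for a division \<open>P\<close> of the longer
  strip.\<close>

lemma is_division_insert_singleton:
  assumes "{Suc n} \<notin> P"
  shows "is_division (Suc n) (insert {Suc n} P) \<longleftrightarrow> is_division n P"
proof -
  have "gapless {Suc n}" by (simp add: gapless_def)
  show ?thesis
  proof
    assume d: "is_division (Suc n) (insert {Suc n} P)"
    have dis: "disjnt {Suc n} (\<Union>P)"
      using is_division_block_unique[OF d, of "{Suc n}"] assms by (auto simp: disjnt_def)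
    have "{1..Suc n} - {Suc n} = {1..n}" by auto
    then show "is_division n P"
      using d partition_on_insert[OF dis, of "{1..Suc n}"] by (simp add: is_division_iff)
  next
    assume d: "is_division n P"
    have dis: "disjnt {Suc n} (\<Union>P)" using Suc_notin_division[OF d] by (auto simp: disjnt_def)
    have "{1..Suc n} - {Suc n} = {1..n}" by auto
    then show "is_division (Suc n) (insert {Suc n} P)"
      using d partition_on_insert[OF dis, of "{1..Suc n}"] \<open>gapless {Suc n}\<close>
      by (simp add: is_division_iff)
  qed
qed

lemma singleton_Suc_notin_division: "is_division n P \<Longrightarrow> {Suc n} \<notin> P"
  using Suc_notin_division by blast

lemma bij_betw_insert_singleton:
  "bij_betw (insert {Suc n}) {P. is_division n P} {P. is_division (Suc n) P \<and> {Suc n} \<in> P}"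
proof (rule bij_betw_byWitness[where f' = "\<lambda>P. P - {{Suc n}}"])
  show "insert {Suc n} ` {P. is_division n P} \<subseteq> {P. is_division (Suc n) P \<and> {Suc n} \<in> P}"
    by (auto simp: is_division_insert_singleton singleton_Suc_notin_division)
  have "is_division n (P - {{Suc n}})" if "is_division (Suc n) P" "{Suc n} \<in> P" for P
    using is_division_insert_singleton[of n "P - {{Suc n}}"] that by (simp add: insert_absorb)
  then show "(\<lambda>P. P - {{Suc n}}) ` {P. is_division (Suc n) P \<and> {Suc n} \<in> P} \<subseteq> {P. is_division n P}"
    by blast
  show "\<forall>P\<in>{P. is_division n P}. insert {Suc n} P - {{Suc n}} = P"
    using Diff_insert_absorb[OF singleton_Suc_notin_division] by auto
  show "\<forall>P\<in>{P. is_division (Suc n) P \<and> {Suc n} \<in> P}. insert {Suc n} (P - {{Suc n}}) = P"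
    by (simp add: insert_absorb)
qed

section \<open>Enumeration by number of pieces, and its recurrence\<close>

section \<open>Generating polynomials\<close>

text \<open>The indeterminate here is the inner one, y. A sum over an infinite \<open>F\<close>
  would be 0 by convention, so finiteness is checked wherever counting depends on it.\<close>

definition gen_poly :: "nat set set set \<Rightarrow> int poly" where
  "gen_poly F = (\<Sum>P\<in>F. monom 1 (card P))"

abbreviation "divisions n \<equiv> {P. is_division n P}"

abbreviation "last_together n \<equiv> {P. is_division n P \<and> together (n - 1) n P}"

text \<open>Together with \<open>last_together\<close> this gives the two states of the recurrence.
  At \<open>n = 1\<close> the truncated \<open>n - 1\<close> is 0, which is no hexagon, so the only
  division counts as apart.\<close>

abbreviation "last_apart n \<equiv> {P. is_division n P \<and> \<not> together (n - 1) n P}"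

lemma gen_poly_Un:
  "finite F \<Longrightarrow> finite G \<Longrightarrow> F \<inter> G = {} \<Longrightarrow> gen_poly (F \<union> G) = gen_poly F + gen_poly G"
  by (simp add: gen_poly_def sum.union_disjoint)

lemma gen_poly_bij_betw:
  assumes "bij_betw f F G" "\<And>P. P \<in> F \<Longrightarrow> card (f P) = card P"
  shows "gen_poly G = gen_poly F"
proof -
  have "gen_poly G = (\<Sum>P\<in>F. monom 1 (card (f P)))"
    unfolding gen_poly_def by (rule sum.reindex_bij_betw[OF assms(1), symmetric])
  also have "\<dots> = gen_poly F"
    unfolding gen_poly_def using assms(2) by (intro sum.cong) auto
  finally show ?thesis .
qed

lemma gen_poly_bij_betw_Suc:
  assumes "bij_betw f F G" "\<And>P. P \<in> F \<Longrightarrow> card (f P) = Suc (card P)"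
  shows "gen_poly G = [:0, 1:] * gen_poly F"
proof -
  have "gen_poly G = (\<Sum>P\<in>F. monom 1 (card (f P)))"
    unfolding gen_poly_def by (rule sum.reindex_bij_betw[OF assms(1), symmetric])
  also have "\<dots> = (\<Sum>P\<in>F. [:0, 1:] * monom 1 (card P))"
    using assms(2) by (intro sum.cong) (auto simp: monom_Suc)
  also have "\<dots> = [:0, 1:] * gen_poly F"
    unfolding gen_poly_def by (rule sum_distrib_left[symmetric])
  finally show ?thesis .
qed

lemma coeff_gen_poly:
  assumes "finite F"
  shows "coeff (gen_poly F) k = int (card {P\<in>F. card P = k})"
proof -
  have "coeff (gen_poly F) k = (\<Sum>P\<in>F. if card P = k then 1 else 0)"
    unfolding gen_poly_def coeff_sum by (intro sum.cong) auto
  also have "\<dots> = int (card {P\<in>F. card P = k})"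
    using assms by (simp add: sum.If_cases Collect_conj_eq)
  finally show ?thesis .
qed

lemma gen_poly_divisions:
  "gen_poly (divisions n) = gen_poly (last_together n) + gen_poly (last_apart n)"
proof -
  have "gen_poly (divisions n) = gen_poly (last_together n \<union> last_apart n)"
    by (rule arg_cong[where f = gen_poly]) blast
  also have "\<dots> = gen_poly (last_together n) + gen_poly (last_apart n)"
  proof (rule gen_poly_Un)
    show "finite (last_together n)" "finite (last_apart n)"
      by (rule finite_subset[OF _ finite_divisions[of n]], blast)+
  qed blast
  finally show ?thesis .
qed

lemma card_attach_Suc: "is_division n P \<Longrightarrow> card (attach (Suc n) m P) = card P"
  by (intro card_attach Suc_notin_division)

text \<open>Joining the block of \<open>n\<close> is possible from either state and creates no new
  piece: this is the first matrix row, 1 and 1.\<close>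

lemma gen_poly_last_together_Suc:
  assumes "n \<ge> 1"
  shows "gen_poly (last_together (Suc n)) = gen_poly (divisions n)"
proof -
  have "bij_betw (attach (Suc n) n) (divisions n) (last_together (Suc n))"
    using bij_betw_attach[of n n] assms by simp
  then show ?thesis
    by (rule gen_poly_bij_betw) (simp add: card_attach_Suc)
qed

lemma gen_poly_singleton:
  "gen_poly {P. is_division (Suc n) P \<and> {Suc n} \<in> P} = [:0, 1:] * gen_poly (divisions n)"
proof (rule gen_poly_bij_betw_Suc[OF bij_betw_insert_singleton])
  fix P assume "P \<in> divisions n"
  then have P: "is_division n P" by simp
  show "card (insert {Suc n} P) = Suc (card P)"
    by (rule card_insert_disjoint[OF is_division_finite[OF P] singleton_Suc_notin_division[OF P]])
qed

text \<open>Gaplessness is applied to the largest companion \<open>m\<close> of \<open>Suc n\<close>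
  in its block, which must be within distance two. Having \<open>n \<ge> 2\<close> in the conclusion
  lets the lemma rule out this case in the strips of lengths 1 and 2.\<close>

lemma last_hexagon_cases:
  assumes P: "is_division (Suc n) P" and "\<not> together n (Suc n) P" "{Suc n} \<notin> P"
  shows "n \<ge> 2 \<and> together (n - 1) (Suc n) P"
proof -
  obtain B where B: "B \<in> P" "Suc n \<in> B" using is_division_obtain_block[OF P, of "Suc n"] by auto
  then have "B \<noteq> {Suc n}" using assms(3) by blast
  then obtain a where a: "a \<in> B" "a \<noteq> Suc n" using B(2) by blast
  have sub: "B \<subseteq> {1..Suc n}" using is_division_block_subset[OF P B(1)] .
  have "n \<notin> B" using assms(2) B by (auto simp: together_def)
  have g: "gapless B" using P B by (auto simp: is_division_iff)
  define m where "m = Max (B - {Suc n})"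
  have "finite (B - {Suc n})" using sub finite_subset by blast
  then have m: "m \<in> B" "m \<noteq> Suc n" "\<And>x. x \<in> B \<Longrightarrow> x \<noteq> Suc n \<Longrightarrow> x \<le> m"
    unfolding m_def using Max_in[of "B - {Suc n}"] a by auto
  then have "1 \<le> m" "m < Suc n" using sub by fastforce+
  then have "Suc m \<in> B \<or> Suc (Suc m) \<in> B" using gaplessD[OF g m(1) B(2)] by auto
  \<comment> \<open>By maximality of \<open>m\<close>, the element of the block found above it can
    only be \<open>Suc n\<close>.\<close>
  then have "m = n \<or> Suc m = n" using m(3)[of "Suc m"] m(3)[of "Suc (Suc m)"] by auto
  then show ?thesis using \<open>n \<notin> B\<close> m(1) \<open>1 \<le> m\<close> B by (auto simp: together_def)
qed

text \<open>Restricts the bijection for \<open>m = n - 1\<close>. Attaching does not change whether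
  \<open>n - 1\<close> and \<open>n\<close> share a block, so the restriction to
  \<open>last_apart\<close> carries over to the image.\<close>

lemma bij_betw_attach_apart:
  assumes "n \<ge> 2"
  shows "bij_betw (attach (Suc n) (n - 1)) (last_apart n)
    {P. is_division (Suc n) P \<and> \<not> together n (Suc n) P \<and> {Suc n} \<notin> P}" (is "bij_betw ?f _ ?G")
proof -
  have b: "bij_betw ?f (divisions n) {P. is_division (Suc n) P \<and> together (n - 1) (Suc n) P}"
    using assms by (intro bij_betw_attach) auto
  \<comment> \<open>Once \<open>n - 1\<close> and \<open>Suc n\<close> share a block, transitivity
    makes \<open>n\<close> apart from one exactly when it is apart from the other.\<close>
  have iff: "\<not> together n (Suc n) P \<and> {Suc n} \<notin> P \<longleftrightarrow>
      together (n - 1) (Suc n) P \<and> \<not> together (n - 1) n P" (is "?L \<longleftrightarrow> ?R")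
    if P: "is_division (Suc n) P" for P
  proof
    assume L: ?L
    then have t: "together (n - 1) (Suc n) P" using last_hexagon_cases[OF P] by simp
    have "\<not> together n (n - 1) P" using together_trans[OF P _ t] L by blast
    then show ?R using t together_commute[of n] by blast
  next
    assume R: ?R
    then have "\<not> together (Suc n) n P" using together_trans[OF P, of "n - 1" "Suc n" n] by blast
    moreover have "n - 1 \<noteq> Suc n" by arith
    then have "{Suc n} \<notin> P" using not_together_if_singleton[OF P] R by blast
    ultimately show ?L using together_commute[of n] by blast
  qed
  then have G: "?G = {P \<in> {P. is_division (Suc n) P \<and> together (n - 1) (Suc n) P}.
      \<not> together (n - 1) n P}"
    by blast
  have t: "together (n - 1) n (?f P) \<longleftrightarrow> together (n - 1) n P" for P
    by (rule together_attach) auto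
  have "?f ` last_apart n = ?G"
    unfolding G bij_betw_imp_surj_on[OF b, symmetric] using t by auto
  then show ?thesis
    by (intro bij_betw_subset[OF b]) auto
qed

lemma last_apart_Suc:
  "last_apart (Suc n) = {P. is_division (Suc n) P \<and> {Suc n} \<in> P} \<union>
    {P. is_division (Suc n) P \<and> \<not> together n (Suc n) P \<and> {Suc n} \<notin> P}"
  using not_together_if_singleton[of "Suc n" _ "Suc n" n] by auto

text \<open>A new singleton contributes y from both states, and attaching to \<open>n - 1\<close>
  contributes 1 from the apart state only: this is the second matrix row, y and 1 + y.\<close>

lemma gen_poly_last_apart_Suc:
  assumes "n \<ge> 2"
  shows "gen_poly (last_apart (Suc n)) =
    [:0, 1:] * gen_poly (divisions n) + gen_poly (last_apart n)"
proof -
  let ?F = "{P. is_division (Suc n) P \<and> {Suc n} \<in> P}"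
  let ?G = "{P. is_division (Suc n) P \<and> \<not> together n (Suc n) P \<and> {Suc n} \<notin> P}"
  have "gen_poly (last_apart (Suc n)) = gen_poly (?F \<union> ?G)"
    by (intro arg_cong[where f = gen_poly] last_apart_Suc)
  also have "\<dots> = gen_poly ?F + gen_poly ?G"
  proof (rule gen_poly_Un)
    show "finite ?F" "finite ?G"
      by (rule finite_subset[OF _ finite_divisions[of "Suc n"]], blast)+
  qed blast
  also have "gen_poly ?F = [:0, 1:] * gen_poly (divisions n)"
    by (rule gen_poly_singleton)
  also have "gen_poly ?G = gen_poly (last_apart n)"
    by (rule gen_poly_bij_betw[OF bij_betw_attach_apart[OF assms]]) (simp add: card_attach_Suc)
  finally show ?thesis .
qed

text \<open>Built from the empty strip, whose sole division has no blocks and so has polynomial 1,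
  by adding hexagon 1 as a singleton.\<close>

lemma gen_poly_divisions_1: "gen_poly (divisions 1) = [:0, 1:]"
proof -
  have "{1} \<in> P" if P: "is_division 1 P" for P
  proof -
    have "\<not> together 0 1 P" using is_division_block_subset[OF P] by (force simp: together_def)
    then show ?thesis using last_hexagon_cases[of 0 P] P by auto
  qed
  then have "divisions 1 = {P. is_division 1 P \<and> {1} \<in> P}" by blast
  moreover have "divisions 0 = {{}}" by (auto simp: is_division_iff partition_on_empty)
  then have "gen_poly (divisions 0) = 1" by (simp add: gen_poly_def)
  ultimately show ?thesis
    using gen_poly_singleton[of 0] by simp
qed

lemma gen_poly_last_together_2: "gen_poly (last_together 2) = [:0, 1:]"
  using gen_poly_last_together_Suc[of 1] gen_poly_divisions_1 by (simp add: numeral_2_eq_2)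

text \<open>The general recurrence fails from length 1 to 2: there is no hexagon 0 to attach to, so
  its second summand must be dropped.\<close>

lemma gen_poly_last_apart_2: "gen_poly (last_apart 2) = [:0, 1:] ^ 2"
proof -
  have "{P. is_division (Suc 1) P \<and> \<not> together 1 (Suc 1) P \<and> {Suc 1} \<notin> P} = {}"
    using last_hexagon_cases[of 1] by auto
  then have "last_apart (Suc 1) = {P. is_division (Suc 1) P \<and> {Suc 1} \<in> P}"
    using last_apart_Suc[of 1] by (simp only: Un_empty_right)
  then have "gen_poly (last_apart (Suc 1)) = [:0, 1:] * gen_poly (divisions 1)"
    using gen_poly_singleton[of 1] by (simp only:)
  then show ?thesis
    unfolding gen_poly_divisions_1 by (simp only: power2_eq_square Suc_1)
qed

section \<open>Iterating the recurrence by matrix powers\<close>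

section \<open>The transfer matrix\<close>

text \<open>The entries are polynomials in y, lifted to constants in x to match the ring of the
  matrices in the theorem.\<close>

definition state_vector :: "nat \<Rightarrow> int poly poly mat" where
  "state_vector n = mat_of_rows_list 1 [[[:gen_poly (last_together n):]], [[:gen_poly (last_apart n):]]]"

abbreviation transfer_matrix :: "int poly poly mat" where
  "transfer_matrix \<equiv> mat_of_rows_list 2 [[1, 1], [var_y, 1 + var_y]]"

lemma mat_of_rows_list_carrier: "length rs = r \<Longrightarrow> mat_of_rows_list c rs \<in> carrier_mat r c"
  by (simp add: mat_of_rows_list_def)

lemma transfer_state_vector:
  assumes "n \<ge> 2"
  shows "transfer_matrix * state_vector n = state_vector (Suc n)"
  using assms gen_poly_last_together_Suc[of n] gen_poly_last_apart_Suc[of n] gen_poly_divisions[of n]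
  by (intro eq_matI)
    (auto simp: state_vector_def mat_of_rows_list_def scalar_prod_def less_Suc_eq var_y_def
      numeral_2_eq_2 algebra_simps one_pCons)

lemma transfer_pow_state_vector:
  assumes "n \<ge> 2"
  shows "transfer_matrix ^\<^sub>m j * state_vector n = state_vector (n + j)"
  using assms
\<comment> \<open>The power unfolds with its extra factor on the right, next to the vector. That
  factor moves the starting length to \<open>Suc n\<close>, so \<open>n\<close> must vary.\<close>
proof (induction j arbitrary: n)
  case 0
  then show ?case
    by (simp add: state_vector_def mat_of_rows_list_def)
next
  case (Suc j)
  have c: "transfer_matrix \<in> carrier_mat 2 2" "state_vector n \<in> carrier_mat 2 1"
    by (simp_all add: mat_of_rows_list_carrier state_vector_def)
  then have "transfer_matrix ^\<^sub>m Suc j * state_vector n =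
      transfer_matrix ^\<^sub>m j * (transfer_matrix * state_vector n)"
    by (simp add: assoc_mult_mat[OF pow_carrier_mat[OF c(1)] c])
  then show ?case
    using Suc transfer_state_vector[of n] by simp
qed

lemma state_vector_2: "state_vector 2 = mat_of_rows_list 1 [[var_y], [var_y ^ 2]]"
  unfolding state_vector_def gen_poly_last_together_2 gen_poly_last_apart_2
  by (simp add: var_y_def power2_eq_square)

lemma row_mult_state_vector:
  "(mat_of_rows_list 2 [[1, 1]] * state_vector n) $$ (0, 0) = [:gen_poly (divisions n):]"
  by (simp add: state_vector_def mat_of_rows_list_def scalar_prod_def gen_poly_divisions
      numeral_2_eq_2)

lemma coeff_mult_var_x_power: "coeff ([:p:] * var_x ^ n) n = p"
proof -
  have "var_x ^ n = monom 1 n" by (simp add: var_x_def monom_altdef)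
  then show ?thesis by simp
qed

theorem theorem14:
  fixes n :: nat and k :: int
  assumes "n \<ge> 2"
  shows "int (num_divisions k n) =
    coeff_xy
      ((mat_of_rows_list 2 [[1, 1]]
        * mat_of_rows_list 2 [[1, 1], [var_y, 1 + var_y]] ^\<^sub>m (n - 2)
        * mat_of_rows_list 1 [[var_y], [var_y ^ 2]]) $$ (0, 0) * var_x ^ n)
      n k"
proof -
  let ?row = "mat_of_rows_list 2 [[1, 1]] :: int poly poly mat"
  have c: "?row \<in> carrier_mat 1 2" "transfer_matrix ^\<^sub>m (n - 2) \<in> carrier_mat 2 2"
    "state_vector 2 \<in> carrier_mat 2 1"
    by (simp_all add: mat_of_rows_list_carrier state_vector_def)
  \<comment> \<open>The product is regrouped so that the power acts on the vector for length 2;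
    \<open>n - 2\<close> transfers then reach length \<open>n\<close>.\<close>
  have "?row * transfer_matrix ^\<^sub>m (n - 2) * state_vector 2 = ?row * state_vector n"
    unfolding assoc_mult_mat[OF c] using transfer_pow_state_vector[of 2 "n - 2"] assms
    by (simp only: le_refl le_add_diff_inverse)
  then have "(?row * transfer_matrix ^\<^sub>m (n - 2) * mat_of_rows_list 1 [[var_y], [var_y ^ 2]]) $$ (0, 0)
      = [:gen_poly (divisions n):]"
    by (simp add: state_vector_2 row_mult_state_vector)
  moreover have "int (num_divisions k n) =
      (if k < 0 then 0 else coeff (gen_poly (divisions n)) (nat k))"
  proof (cases "k < 0")
    \<comment> \<open>No division has a negative number of pieces, which agrees with the value 0
      that \<open>coeff_xy\<close> takes there.\<close>
    case True
    then have "{P. is_division n P \<and> int (card P) = k} = {}" by auto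
    then show ?thesis using True by (simp add: num_divisions_def)
  next
    case False
    then have "int m = k \<longleftrightarrow> m = nat k" for m by auto
    then show ?thesis
      using False by (simp add: num_divisions_def coeff_gen_poly[OF finite_divisions])
  qed
  ultimately show ?thesis
    by (simp add: coeff_xy_def coeff_mult_var_x_power del: mult_pCons_left)
qed

end
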